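(* Let $n\geq 2$ be an integer, let $A$ be a non-empty subset of $U(n)$, and let $S$ be a sequence in $\mathbb Z_n$. Then $S$ is a $C$-extremal sequence for $(A,\mathbb Z_n')$ if and only if $S=(0,x_1,0,x_2,0,\ldots,0,x_k,0)$ where $(x_1,\ldots,x_k)$ is a $C$-extremal sequence for $A$.
   Context: $\mathbb Z_n=\mathbb Z/n\mathbb Z$ as a module over itself, $\mathbb Z_n'=\mathbb Z_n\setminus\{0\}$, $U(n)$ the group of units of $\mathbb Z_n$. A sequence $(x_1,\ldots,x_k)$ is an $A$-weighted zero-sum sequence if there exist $a_i\in A$ with $\sum a_ix_i=0$, and an $(A,B)$-weighted zero-sum sequence if there exist $a_i\in A$, $b_i\in B$ with $\sum a_ix_i=0$ and $\sum b_ia_i=0$. $C_{A,B}(n)$ (resp. $C_A(n)$) is the least positive $k$ such that every sequence of length $k$ in $\mathbb Z_n$ has an $(A,B)$-weighted (resp. $A$-weighted) zero-sum subsequence having consecutive terms, i.e. a non-empty block $(x_i,\ldots,x_j)$. A $C$-extremal sequence for $(A,B)$ (resp. for $A$) is a sequence of length $C_{A,B}(n)-1$ (resp. $C_A(n)-1$) with no such subsequence having consecutive terms.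
   Formalization: For n = 2 the sequence S = (1,0,1) is excluded: with A = Z_2' = {1} it is a C-extremal sequence for (A, Z_2') but is not of the form (0,x_1,0,…,0,x_k,0), so the claim as stated fails for exactly this one sequence. *)

theory Defs
  imports "HOL-Number_Theory.Residues" "HOL-Library.Sublist"
begin

text \<open>
  The ring of integers modulo \<open>n\<close> is \<^term>\<open>residue_ring n\<close>, with carrier \<open>{0..n - 1}\<close>.
  Sequences are lists over the carrier.  Blocks of consecutive terms are contiguous sublists in
  the sense of \<^const>\<open>sublist\<close>.
\<close>

definition weighted_zero_sum :: "int \<Rightarrow> int set \<Rightarrow> int list \<Rightarrow> bool" where
  "weighted_zero_sum n A xs \<longleftrightarrow>
     (\<exists>as. length as = length xs \<and> set as \<subseteq> A \<and>
       (\<Oplus>\<^bsub>residue_ring n\<^esub>i\<in>{..<length xs}. as ! i \<otimes>\<^bsub>residue_ring n\<^esub> xs ! i)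
         = \<zero>\<^bsub>residue_ring n\<^esub>)"

definition weighted_zero_sum2 :: "int \<Rightarrow> int set \<Rightarrow> int set \<Rightarrow> int list \<Rightarrow> bool" where
  "weighted_zero_sum2 n A B xs \<longleftrightarrow>
     (\<exists>as bs. length as = length xs \<and> set as \<subseteq> A \<and> length bs = length xs \<and> set bs \<subseteq> B \<and>
       (\<Oplus>\<^bsub>residue_ring n\<^esub>i\<in>{..<length xs}. as ! i \<otimes>\<^bsub>residue_ring n\<^esub> xs ! i)
         = \<zero>\<^bsub>residue_ring n\<^esub> \<and>
       (\<Oplus>\<^bsub>residue_ring n\<^esub>i\<in>{..<length xs}. bs ! i \<otimes>\<^bsub>residue_ring n\<^esub> as ! i)
         = \<zero>\<^bsub>residue_ring n\<^esub>)"

definition has_block :: "(int list \<Rightarrow> bool) \<Rightarrow> int list \<Rightarrow> bool" where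
  "has_block P xs \<longleftrightarrow> (\<exists>ys. ys \<noteq> [] \<and> sublist ys xs \<and> P ys)"

text \<open>
  \<open>C_const n P\<close> is the least positive \<open>k\<close> such that every sequence of length \<open>k\<close> has a non-empty
  block satisfying \<open>P\<close>.  If there is no such \<open>k\<close> (for instance, if the weight set is empty), its
  value is unspecified.
\<close>

definition C_const :: "int \<Rightarrow> (int list \<Rightarrow> bool) \<Rightarrow> nat" where
  "C_const n P =
     (LEAST k. 0 < k \<and>
       (\<forall>xs. length xs = k \<and> set xs \<subseteq> carrier (residue_ring n) \<longrightarrow> has_block P xs))"

definition C_extremal_for :: "int \<Rightarrow> (int list \<Rightarrow> bool) \<Rightarrow> int list \<Rightarrow> bool" where
  "C_extremal_for n P xs \<longleftrightarrow>
     set xs \<subseteq> carrier (residue_ring n) \<and> length xs = C_const n P - 1 \<and> \<not> has_block P xs"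

definition C_extremal :: "int \<Rightarrow> int set \<Rightarrow> int list \<Rightarrow> bool" where
  "C_extremal n A = C_extremal_for n (weighted_zero_sum n A)"

definition C_extremal2 :: "int \<Rightarrow> int set \<Rightarrow> int set \<Rightarrow> int list \<Rightarrow> bool" where
  "C_extremal2 n A B = C_extremal_for n (weighted_zero_sum2 n A B)"

definition nonzero_residues :: "int \<Rightarrow> int set" where
  "nonzero_residues n = carrier (residue_ring n) - {\<zero>\<^bsub>residue_ring n\<^esub>}"

fun zero_interleave :: "int \<Rightarrow> int list \<Rightarrow> int list" where
  "zero_interleave n [] = [\<zero>\<^bsub>residue_ring n\<^esub>]"
| "zero_interleave n (x # xs) = \<zero>\<^bsub>residue_ring n\<^esub> # x # zero_interleave n xs"

lemma finsum_residue_ring: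
  assumes "1 < n"
  shows "(\<Oplus>\<^bsub>residue_ring n\<^esub>i\<in>{..<k::nat}. f i \<otimes>\<^bsub>residue_ring n\<^esub> g i)
    = (\<Sum>i<k. f i * g i) mod n"
proof -
  interpret residues n "residue_ring n" using assms by unfold_locales simp_all
  have "(\<Oplus>\<^bsub>residue_ring n\<^esub>i\<in>{..<k}. (f i * g i) mod n) = (\<Sum>i<k. f i * g i) mod n"
    by (rule sum_cong) simp
  then show ?thesis by (simp add: residue_ring_def)
qed

lemma weighted_zero_sum2_mod_2:
  "weighted_zero_sum2 2 {1} (nonzero_residues 2) xs \<longleftrightarrow> even (length xs) \<and> even (sum_list xs)"
proof -
  have B: "nonzero_residues 2 = {1}"
    by (auto simp: nonzero_residues_def residue_ring_def)
  have w: "length as = length xs \<and> set as \<subseteq> {1} \<longleftrightarrow> as = replicate (length xs) 1" for as :: "int list"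
    by (auto simp: replicate_eq_replicate set_replicate_conv_if intro: replicate_eqI[symmetric] split: if_splits)
      (metis replicate_length_same subset_singletonD singletonD empty_iff subsetD)+
  have s: "(\<Sum>i<length xs. xs ! i) = sum_list xs"
    by (simp add: sum_list_sum_nth atLeast0LessThan)
  have "weighted_zero_sum2 2 {1} {1} xs \<longleftrightarrow>
    (\<exists>as bs. as = replicate (length xs) 1 \<and> bs = replicate (length xs) 1 \<and>
      (\<Sum>i<length xs. as ! i * xs ! i) mod 2 = 0 \<and> (\<Sum>i<length xs. bs ! i * as ! i) mod 2 = 0)"
    unfolding weighted_zero_sum2_def w[symmetric]
    by (simp add: finsum_residue_ring conj_ac) (simp add: residue_ring_def)
  then show ?thesis
    by (auto simp: B s even_iff_mod_2_eq_zero[symmetric])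
qed

text \<open>
  Modulo 2 the condition on the second weights forces blocks of even length, so the constant is 4
  and \<open>(1, 0, 1)\<close> is a \<open>C\<close>-extremal sequence for the only possible weight set \<open>{1}\<close>.  It is
  not of the form \<open>(0, x\<^sub>1, 0, \<dots>, x\<^sub>k, 0)\<close>, hence it has to be excluded from the
  characterisation of extremal sequences.
\<close>

lemma C_extremal2_mod_2:
  "C_extremal2 2 {1} (nonzero_residues 2) [1, 0, 1] \<and> (\<nexists>xs. [1, 0, 1] = zero_interleave 2 xs)"
proof -
  define P where "P = weighted_zero_sum2 2 {1} (nonzero_residues 2)"
  have P: "P xs \<longleftrightarrow> even (length xs) \<and> even (sum_list xs)" for xs
    unfolding P_def by (rule weighted_zero_sum2_mod_2)
  have no: "\<not> has_block P [1, 0, 1]"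
    by (auto simp: has_block_def P sublist_Cons_right prefix_Cons)
  have four: "has_block P xs" if "length xs = 4" for xs
  proof -
    have xs: "xs = [xs ! 0, xs ! 1, xs ! 2, xs ! 3]"
      using that by (auto simp: list_eq_iff_nth_eq less_Suc_eq numeral_eq_Suc)
    define a b c d where "a = xs ! 0" "b = xs ! 1" "c = xs ! 2" "d = xs ! 3"
    note xs = xs[folded this]
    consider "even (a + b)" | "even (c + d)" | "even (a + b + c + d)" by fastforce
    then show ?thesis
    proof cases
      case 1
      then show ?thesis
        unfolding has_block_def P xs
        by (intro exI[of _ "[a, b]"]) (auto simp: sublist_Cons_right)
    next
      case 2
      then show ?thesis
        unfolding has_block_def P xs
        by (intro exI[of _ "[c, d]"]) (auto simp: sublist_Cons_right)
    next
      case 3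
      then show ?thesis
        unfolding has_block_def P xs
        by (intro exI[of _ "[a, b, c, d]"]) (auto simp: add_ac)
    qed
  qed
  have "C_const 2 P = 4"
    unfolding C_const_def
  proof (rule Least_equality)
    fix k :: nat
    assume k: "0 < k \<and> (\<forall>xs. length xs = k \<and> set xs \<subseteq> carrier (residue_ring 2) \<longrightarrow> has_block P xs)"
    show "4 \<le> k"
    proof (rule ccontr)
      assume "\<not> 4 \<le> k"
      moreover have "set (take k [1, 0, 1]) \<subseteq> carrier (residue_ring 2)"
        using set_take_subset[of k "[1, 0, 1 :: int]"] by (auto simp: residue_ring_def)
      ultimately have "has_block P (take k [1, 0, 1])" using k by simp
      then have "has_block P [1, 0, 1]"
        unfolding has_block_def by (meson sublist_order.order_trans sublist_take)
      then show False using no by simp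
    qed
  qed (use four in auto)
  then have "C_extremal2 2 {1} (nonzero_residues 2) [1, 0, 1]"
    using no by (simp add: C_extremal2_def C_extremal_for_def P_def[symmetric])
      (simp add: residue_ring_def)
  moreover have "[1, 0, 1] \<noteq> zero_interleave 2 xs" for xs
    by (cases xs) (simp_all add: residue_ring_def)
  ultimately show ?thesis by blast
qed

end

theory Submission
  imports Defs
begin

text \<open>
  Units can be cancelled, so for \<open>n \<ge> 3\<close> the second condition (non-zero weights \<open>b\<^sub>i\<close> with
  \<open>\<Sum> b\<^sub>i a\<^sub>i = 0\<close>) can be met for every block except those of length 1.  A sequence \<open>S\<close> without
  an \<open>A\<close>-weighted zero-sum block of length at least 2 has no two adjacent zeros, so its length is
  at most \<open>2 m + 1\<close>, where \<open>m\<close> is the number of its non-zero terms, with equality only if the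
  zeros interleave these terms; and the sequence of non-zero terms has no \<open>A\<close>-weighted zero-sum
  block at all.  Hence the longest such \<open>S\<close> are the interleavings of the longest sequences
  without an \<open>A\<close>-weighted zero-sum block.
\<close>

section \<open>Weighted sums\<close>

text \<open>The sums are integers and the recursion follows the list, so inductions on the sequence
  need neither indices nor ring operations. Reduction modulo \<open>n\<close> enters only as a
  divisibility test on the result.\<close>

fun weighted_sums :: "int set \<Rightarrow> int list \<Rightarrow> int set" where
  "weighted_sums A [] = {0}"
| "weighted_sums A (x # xs) = {a * x + s |a s. a \<in> A \<and> s \<in> weighted_sums A xs}"

lemma weighted_sums_eq:
  "weighted_sums A xs =
     {\<Sum>i<length xs. as ! i * xs ! i |as. length as = length xs \<and> set as \<subseteq> A}"
proof (induction xs)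
  case (Cons x xs)
  show ?case
  proof (intro equalityI subsetI)
    fix t
    assume "t \<in> weighted_sums A (x # xs)"
    then obtain a as where "a \<in> A" "length as = length xs" "set as \<subseteq> A"
      "t = a * x + (\<Sum>i<length xs. as ! i * xs ! i)"
      using Cons.IH by auto
    then show "t \<in> {\<Sum>i<length (x # xs). as ! i * (x # xs) ! i |as.
        length as = length (x # xs) \<and> set as \<subseteq> A}"
      by (intro CollectI exI[of _ "a # as"]) (simp add: sum.lessThan_Suc_shift del: sum.lessThan_Suc)
  next
    fix t
    assume "t \<in> {\<Sum>i<length (x # xs). as ! i * (x # xs) ! i |as.
        length as = length (x # xs) \<and> set as \<subseteq> A}"
    then obtain as where as: "length as = length (x # xs)" "set as \<subseteq> A"
      and t: "t = (\<Sum>i<length (x # xs). as ! i * (x # xs) ! i)" by blast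
    then obtain a as' where "as = a # as'" by (cases as) auto
    with as t show "t \<in> weighted_sums A (x # xs)"
      by (auto simp: Cons.IH sum.lessThan_Suc_shift simp del: sum.lessThan_Suc)
  qed
qed simp

lemma weighted_zero_sum_iff:
  assumes "1 < n"
  shows "weighted_zero_sum n A xs \<longleftrightarrow> (\<exists>s\<in>weighted_sums A xs. n dvd s)"
proof -
  have "\<zero>\<^bsub>residue_ring n\<^esub> = 0" by (simp add: residue_ring_def)
  then show ?thesis
    unfolding weighted_zero_sum_def weighted_sums_eq finsum_residue_ring[OF assms]
    by (auto simp: dvd_eq_mod_eq_0)
qed

text \<open>The condition on the \<open>bs\<close> says that \<open>as\<close>, now read as a
  sequence, is zero-sum with weights in \<open>B\<close>. The two conditions can thus be studied
  separately.\<close>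

lemma weighted_zero_sum2_iff:
  "weighted_zero_sum2 n A B xs \<longleftrightarrow>
     (\<exists>as. length as = length xs \<and> set as \<subseteq> A \<and>
       (\<Oplus>\<^bsub>residue_ring n\<^esub>i\<in>{..<length xs}. as ! i \<otimes>\<^bsub>residue_ring n\<^esub> xs ! i)
         = \<zero>\<^bsub>residue_ring n\<^esub> \<and> weighted_zero_sum n B as)"
  unfolding weighted_zero_sum2_def weighted_zero_sum_def by (metis (no_types, lifting))

text \<open>A zero term contributes 0 under every weight. When zeros are put back, some weight must
  exist for them, hence \<open>A\<close> is non-empty.\<close>

lemma weighted_sums_filter_nonzero:
  assumes "A \<noteq> {}"
  shows "weighted_sums A (filter (\<lambda>x. x \<noteq> 0) xs) = weighted_sums A xs"
  using assms by (induction xs) auto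

lemma weighted_zero_sum_filter_nonzero:
  assumes "1 < n" "A \<noteq> {}"
  shows "weighted_zero_sum n A (filter (\<lambda>x. x \<noteq> 0) xs) \<longleftrightarrow> weighted_zero_sum n A xs"
  using assms by (simp add: weighted_zero_sum_iff weighted_sums_filter_nonzero)

lemma constant_weights: "a \<in> A \<Longrightarrow> a * sum_list xs \<in> weighted_sums A xs"
  by (induction xs) (auto simp: distrib_left)

section \<open>Units modulo \<open>n\<close> and the second weights\<close>

lemma carrier_residue_ring: "carrier (residue_ring n) = {0..n - 1}"
  by (simp add: residue_ring_def)

lemma zero_residue_ring: "\<zero>\<^bsub>residue_ring n\<^esub> = 0"
  by (simp add: residue_ring_def)

lemma nonzero_residues_eq: "nonzero_residues n = {1..n - 1}"
  by (auto simp: nonzero_residues_def residue_ring_def)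

lemma Units_residue_ring_iff:
  assumes "1 < n"
  shows "a \<in> Units (residue_ring n) \<longleftrightarrow> 0 < a \<and> a < n \<and> coprime a n"
proof -
  interpret residues n "residue_ring n" using assms by unfold_locales simp_all
  show ?thesis by (simp add: res_units_eq)
qed

lemma weighted_zero_sum_singleton:
  assumes "1 < n" "A \<noteq> {}" "A \<subseteq> Units (residue_ring n)" "x \<in> carrier (residue_ring n)"
  shows "weighted_zero_sum n A [x] \<longleftrightarrow> x = 0"
proof
  assume "weighted_zero_sum n A [x]"
  then obtain a where "a \<in> A" "n dvd a * x"
    using assms(1) by (auto simp: weighted_zero_sum_iff)
  moreover have "coprime n a"
    using \<open>a \<in> A\<close> assms(1,3) by (auto simp: Units_residue_ring_iff coprime_commute)
  ultimately have "n dvd x" by (simp add: coprime_dvd_mult_right_iff)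
  then show "x = 0"
    using assms(4) by (auto simp: carrier_residue_ring dest: zdvd_imp_le)
qed (use assms in \<open>auto simp: weighted_zero_sum_iff\<close>)

text \<open>
  A target \<open>r\<close> that is non-zero modulo \<open>n\<close> stays non-zero after subtracting \<open>a\<close> or \<open>2 a\<close>, which
  both carry a non-zero weight because \<open>n \<ge> 3\<close>.
\<close>

lemma nonzero_weights_reach_nonzero:
  assumes "3 \<le> n" "as \<noteq> []" "\<forall>a\<in>set as. coprime a n" "\<not> n dvd r"
  shows "\<exists>s\<in>weighted_sums (nonzero_residues n) as. [s = r] (mod n)"
  using assms(2-)
proof (induction as arbitrary: r rule: list_nonempty_induct)
  case (single a)
  then obtain c where c: "[a * c = 1] (mod n)"
    by (auto dest: cong_solve_coprime_int)
  \<comment> \<open>Since \<open>c\<close> inverts \<open>a\<close>, this is the solution of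
    \<open>b * a = r\<close> modulo \<open>n\<close>; it is non-zero because \<open>n\<close> does
    not divide \<open>r\<close>.\<close>
  define b where "b = (c * r) mod n"
  have "[b * a = r] (mod n)"
  proof -
    have "[b * a = (a * c) * r] (mod n)"
      by (simp add: b_def cong_def mod_mult_right_eq mult.assoc mult.commute[of _ a])
    also have "[(a * c) * r = 1 * r] (mod n)" using c by (rule cong_scalar_right)
    finally show ?thesis by simp
  qed
  moreover have "0 \<le> b" "b < n" using assms(1) by (simp_all add: b_def)
  moreover have "b \<noteq> 0"
    using \<open>[b * a = r] (mod n)\<close> single by (auto simp: cong_0_iff cong_sym_eq[of 0])
  then have "b \<in> nonzero_residues n"
    using assms(1) \<open>0 \<le> b\<close> \<open>b < n\<close> by (simp add: nonzero_residues_eq)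
  ultimately show ?case by auto
next
  case (cons a as)
  have "\<not> n dvd a"
    using cons.prems assms(1) by (auto simp: coprime_absorb_right)
  \<comment> \<open>The two candidates differ by \<open>a\<close>, so \<open>n\<close> cannot divide
    both.\<close>
  then have "\<not> n dvd r - 1 * a \<or> \<not> n dvd r - 2 * a"
    using dvd_diff[of n "r - 1 * a" "r - 2 * a"] by auto
  then obtain b where b: "b \<in> {1, 2}" "\<not> n dvd r - b * a" by blast
  then obtain s where s: "s \<in> weighted_sums (nonzero_residues n) as" "[s = r - b * a] (mod n)"
    using cons by fastforce
  have "[b * a + s = b * a + (r - b * a)] (mod n)"
    using s(2) by (intro cong_add cong_refl)
  moreover have "b \<in> nonzero_residues n" using b assms(1) by (auto simp: nonzero_residues_eq)
  ultimately show ?case using s(1) by auto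
qed

text \<open>With at least two terms, the first gets weight 1 and the others are made to sum to its
  negative, which is non-zero modulo \<open>n\<close>. A single unit cannot be killed by a non-zero
  weight, and the empty sum is 0.\<close>

lemma weighted_zero_sum_units_nonzero_weights:
  assumes "3 \<le> n" "set as \<subseteq> Units (residue_ring n)"
  shows "weighted_zero_sum n (nonzero_residues n) as \<longleftrightarrow> length as \<noteq> 1"
proof -
  have co: "\<forall>a\<in>set as. coprime a n"
    using assms by (auto simp: Units_residue_ring_iff)
  consider "as = []" | a where "as = [a]" | a as' where "as = a # as'" "as' \<noteq> []"
    by (cases as) auto
  then show ?thesis
  proof cases
    case 1
    then show ?thesis using assms(1) by (simp add: weighted_zero_sum_iff)
  next
    case 2
    have "\<not> n dvd b * a" if "b \<in> nonzero_residues n" for b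
      using co 2 that
      by (auto simp: coprime_dvd_mult_left_iff coprime_commute nonzero_residues_eq dest: zdvd_imp_le)
    with 2 show ?thesis using assms(1) by (auto simp: weighted_zero_sum_iff)
  next
    case 3
    then have "\<not> n dvd - a" using co assms(1) by (auto simp: coprime_absorb_right)
    then obtain s where s: "s \<in> weighted_sums (nonzero_residues n) as'" "[s = - a] (mod n)"
      using nonzero_weights_reach_nonzero[of n as' "- a"] 3 co assms(1) by auto
    have "[1 * a + s = 1 * a + - a] (mod n)"
      using s(2) by (intro cong_add) auto
    then have "n dvd 1 * a + s" by (simp add: cong_0_iff)
    moreover have "(1::int) \<in> nonzero_residues n" using assms(1) by (simp add: nonzero_residues_eq)
    ultimately have "weighted_zero_sum n (nonzero_residues n) as"
      unfolding 3 using s(1) assms(1) by (subst weighted_zero_sum_iff) (simp, fastforce)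
    then show ?thesis using 3 by (cases as') auto
  qed
qed

text \<open>Whether second weights exist depends only on the length of \<open>as\<close>, so the
  condition moves out of the quantifier over \<open>as\<close>.\<close>

lemma weighted_zero_sum2_iff_length:
  assumes "3 \<le> n" "A \<subseteq> Units (residue_ring n)"
  shows "weighted_zero_sum2 n A (nonzero_residues n) xs \<longleftrightarrow>
    weighted_zero_sum n A xs \<and> length xs \<noteq> 1"
proof -
  have "weighted_zero_sum n (nonzero_residues n) as \<longleftrightarrow> length xs \<noteq> 1"
    if "length as = length xs" "set as \<subseteq> A" for as
    using weighted_zero_sum_units_nonzero_weights[of n as] that assms by auto
  then show ?thesis
    unfolding weighted_zero_sum2_iff weighted_zero_sum_def[of n A] by blast
qed

section \<open>Extremal sequences as longest block-free sequences\<close>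

lemma has_block_sublist: "has_block P xs \<Longrightarrow> sublist xs ys \<Longrightarrow> has_block P ys"
  unfolding has_block_def by (meson sublist_order.order_trans)

text \<open>Prefixes of block-free sequences are block-free, so the lengths of such sequences have
  no gaps and \<open>C_const n P - 1\<close> is the largest of them. The bound \<open>k\<close>
  ensures that the \<open>LEAST\<close> is attained.\<close>

lemma C_extremal_for_iff_longest:
  assumes bound: "\<And>xs. set xs \<subseteq> carrier (residue_ring n) \<Longrightarrow> \<not> has_block P xs \<Longrightarrow> length xs < k"
  shows "C_extremal_for n P xs \<longleftrightarrow> set xs \<subseteq> carrier (residue_ring n) \<and> \<not> has_block P xs \<and>
    (\<forall>ys. set ys \<subseteq> carrier (residue_ring n) \<and> \<not> has_block P ys \<longrightarrow> length ys \<le> length xs)"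
proof -
  define good where "good k \<longleftrightarrow> 0 < k \<and>
    (\<forall>xs. length xs = k \<and> set xs \<subseteq> carrier (residue_ring n) \<longrightarrow> has_block P xs)" for k
  have C: "C_const n P = (LEAST k. good k)" by (simp add: C_const_def good_def)
  have "good (Suc k)" using bound by (fastforce simp: good_def)
  then have good: "good (C_const n P)" unfolding C by (rule LeastI)
  have nil: "\<not> has_block P []" by (simp add: has_block_def)
  have short: "length ys \<le> C_const n P - 1"
    if "set ys \<subseteq> carrier (residue_ring n)" "\<not> has_block P ys" for ys
  proof (rule ccontr)
    assume "\<not> ?thesis"
    then have "length (take (C_const n P) ys) = C_const n P" by simp
    moreover have "set (take (C_const n P) ys) \<subseteq> carrier (residue_ring n)"
      using that(1) set_take_subset by fastforce
    ultimately have "has_block P (take (C_const n P) ys)" using good by (simp add: good_def)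
    with that(2) show False using has_block_sublist sublist_take by blast
  qed
  obtain zs where zs: "length zs = C_const n P - 1" "set zs \<subseteq> carrier (residue_ring n)"
    "\<not> has_block P zs"
  \<comment> \<open>Minimality says nothing about length 0, as \<open>good\<close> demands
    positivity; there the empty sequence serves.\<close>
  proof (cases "C_const n P = 1")
    case True
    with nil that[of "[]"] show ?thesis by simp
  next
    case False
    with good have "0 < C_const n P - 1" "C_const n P - 1 < C_const n P"
      by (auto simp: good_def)
    then have "\<not> good (C_const n P - 1)" unfolding C using not_less_Least by blast
    with \<open>0 < C_const n P - 1\<close> that show ?thesis by (auto simp: good_def)
  qed
  show ?thesis
    unfolding C_extremal_for_def using short zs by (metis le_antisym)
qed

lemma exists_C_extremal_for:
  assumes "\<And>xs. set xs \<subseteq> carrier (residue_ring n) \<Longrightarrow> \<not> has_block P xs \<Longrightarrow> length xs < k"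
  shows "\<exists>xs. C_extremal_for n P xs"
proof -
  have "\<exists>xs. (set xs \<subseteq> carrier (residue_ring n) \<and> \<not> has_block P xs) \<and>
    (\<forall>ys. set ys \<subseteq> carrier (residue_ring n) \<and> \<not> has_block P ys \<longrightarrow> length ys \<le> length xs)"
    using assms
    by (intro ex_has_greatest_nat[where k = "[]" and b = k])
      (auto simp: has_block_def less_imp_le)
  then obtain xs where "set xs \<subseteq> carrier (residue_ring n)" "\<not> has_block P xs"
    "\<forall>ys. set ys \<subseteq> carrier (residue_ring n) \<and> \<not> has_block P ys \<longrightarrow> length ys \<le> length xs"
    by blast
  then have "C_extremal_for n P xs"
    by (subst C_extremal_for_iff_longest[OF assms]) auto
  then show ?thesis ..
qed

text \<open>
  Two of the \<open>n + 1\<close> initial segments have the same sum modulo \<open>n\<close>; the block between them is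
  zero-sum with constant weights.
\<close>

lemma has_block_weighted_zero_sum:
  assumes "1 < n" "A \<noteq> {}" "nat n \<le> length xs"
  shows "has_block (weighted_zero_sum n A) xs"
proof -
  define f where "f j = sum_list (take j xs) mod n" for j
  have "f ` {0..nat n} \<subseteq> {0..<n}" using assms(1) by (auto simp: f_def)
  then have "card (f ` {0..nat n}) \<le> card {0..<n}" by (intro card_mono) auto
  then have "\<not> inj_on f {0..nat n}" by (intro pigeonhole) simp
  then obtain i j where ij: "i < j" "j \<le> nat n" "f i = f j"
    unfolding inj_on_def by (metis atLeastAtMost_iff linorder_neqE_nat)
  define ys where "ys = drop i (take j xs)"
  have "take j xs = take i xs @ ys"
    using ij(1) append_take_drop_id[of i "take j xs"] by (simp add: ys_def min_def)
  then have "sum_list (take j xs) = sum_list (take i xs) + sum_list ys" by simp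
  then have "n dvd sum_list ys"
    using ij(3) by (simp add: f_def mod_eq_dvd_iff)
  moreover obtain a where "a \<in> A" using assms(2) by blast
  ultimately have "weighted_zero_sum n A ys"
    using assms(1) constant_weights[of a A ys] weighted_zero_sum_iff[of n A ys] dvd_mult by blast
  \<comment> \<open>As \<open>j\<close> does not exceed the length of \<open>xs\<close>,
    \<open>take j\<close> is not cut short and \<open>ys\<close> has \<open>j - i > 0\<close>
    terms.\<close>
  moreover have "ys \<noteq> []" using ij assms(3) by (simp add: ys_def)
  moreover have "sublist ys xs"
    unfolding ys_def by (meson sublist_order.order_trans sublist_drop sublist_take)
  ultimately show ?thesis unfolding has_block_def by blast
qed

section \<open>Interleaving with zeros\<close>

lemma length_zero_interleave: "length (zero_interleave n xs) = 2 * length xs + 1"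
  by (induction xs) auto

lemma set_zero_interleave: "set (zero_interleave n xs) = insert 0 (set xs)"
  by (induction xs) (auto simp: zero_residue_ring)

lemma filter_zero_interleave:
  "filter (\<lambda>x. x \<noteq> 0) (zero_interleave n xs) = filter (\<lambda>x. x \<noteq> 0) xs"
  by (induction xs) (auto simp: zero_residue_ring)

lemma no_adjacent_zeros_zero_interleave:
  "0 \<notin> set xs \<Longrightarrow> \<not> sublist [0, 0] (zero_interleave n xs)"
  by (induction xs) (auto simp: zero_residue_ring sublist_Cons_right)

text \<open>Any two consecutive terms include a non-zero one; removing terms in pairs leaves at most
  one unpaired zero.\<close>

lemma length_no_adjacent_zeros:
  assumes "\<not> sublist [0, 0] xs"
  shows "length xs \<le> 2 * length (filter (\<lambda>x. x \<noteq> 0) xs) + 1"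
  using assms
proof (induction xs rule: induct_list012)
  case (3 x y zs)
  then show ?case by (cases "x = 0"; cases "y = 0") (auto simp: sublist_Cons_right)
qed auto

lemma zero_interleave_filter_nonzero:
  assumes "\<not> sublist [0, 0] xs" "length xs = 2 * length (filter (\<lambda>x. x \<noteq> 0) xs) + 1"
  shows "xs = zero_interleave n (filter (\<lambda>x. x \<noteq> 0) xs)"
  using assms
proof (induction xs rule: induct_list012)
  case (3 x y zs)
  have "x = 0"
  proof (rule ccontr)
    assume "x \<noteq> 0"
    \<comment> \<open>With \<open>m\<close> non-zero terms in all, the tail would have length
      \<open>2 m\<close> but only \<open>m - 1\<close> non-zero terms, against the bound
      \<open>2 m - 1\<close>.\<close>
    then show False
      using 3(3,4) length_no_adjacent_zeros[of "y # zs"] by (auto simp: sublist_Cons_right)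
  qed
  with 3(3) have "y \<noteq> 0" by (auto simp: sublist_Cons_right)
  with \<open>x = 0\<close> 3 show ?case by (auto simp: zero_residue_ring sublist_Cons_right)
qed (auto simp: zero_residue_ring split: if_splits)

section \<open>Block-free sequences under deletion and insertion of zeros\<close>

lemma filter_eq_appendD:
  assumes "filter P xs = us @ vs"
  shows "\<exists>us' vs'. xs = us' @ vs' \<and> us = filter P us' \<and> vs = filter P vs'"
  using assms
proof (induction xs arbitrary: us)
  case (Cons x xs)
  show ?case
  proof (cases "us = [] \<or> \<not> P x")
    case True
    then show ?thesis
    proof
      assume "us = []"
      then show ?thesis using Cons.prems by (intro exI[of _ "[]"] exI[of _ "x # xs"]) simp
    next
      assume "\<not> P x"
      then obtain us' vs' where "xs = us' @ vs'" "us = filter P us'" "vs = filter P vs'"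
        using Cons by auto
      with \<open>\<not> P x\<close> show ?thesis by (intro exI[of _ "x # us'"] exI[of _ vs']) simp
    qed
  next
    case False
    then obtain us1 where us: "us = x # us1" and "filter P xs = us1 @ vs"
      using Cons.prems by (cases us) auto
    then obtain us' vs' where "xs = us' @ vs'" "us1 = filter P us'" "vs = filter P vs'"
      using Cons.IH by blast
    with False us show ?thesis by (intro exI[of _ "x # us'"] exI[of _ vs']) simp
  qed
qed simp

text \<open>A zero-sum block of the non-zero terms lifts to a block of \<open>xs\<close> by
  restoring the zeros in between, which leaves its weighted sums unchanged.\<close>

lemma block_free_filter_nonzero:
  assumes "1 < n" "A \<noteq> {}" "A \<subseteq> Units (residue_ring n)"
    and "set xs \<subseteq> carrier (residue_ring n)"
    and free: "\<not> has_block (\<lambda>xs. weighted_zero_sum n A xs \<and> length xs \<noteq> 1) xs"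
  shows "\<not> has_block (weighted_zero_sum n A) (filter (\<lambda>x. x \<noteq> 0) xs)"
proof
  assume "has_block (weighted_zero_sum n A) (filter (\<lambda>x. x \<noteq> 0) xs)"
  then obtain us ys vs where ys: "ys \<noteq> []" "weighted_zero_sum n A ys"
    and eq: "filter (\<lambda>x. x \<noteq> 0) xs = us @ ys @ vs"
    by (auto simp: has_block_def sublist_def)
  from eq obtain us' ys' vs' where xs: "xs = us' @ ys' @ vs'"
    and ys': "ys = filter (\<lambda>x. x \<noteq> 0) ys'"
    by (metis filter_eq_appendD)
  \<comment> \<open>A unit times a non-zero residue is non-zero, so one term alone cannot be
    zero-sum. The lifted block therefore has at least two terms.\<close>
  have "length ys \<noteq> 1"
  proof
    assume "length ys = 1"
    then obtain y where y: "ys = [y]" by (auto simp: length_Suc_conv)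
    then have "y \<in> set ys'" "y \<noteq> 0" using ys' by (auto simp: filter_eq_Cons_iff)
    then show False
      using weighted_zero_sum_singleton[OF assms(1-3), of y] ys(2) y assms(4) xs by auto
  qed
  moreover have "length ys \<le> length ys'" by (simp add: ys')
  ultimately have "length ys' \<noteq> 1" "ys' \<noteq> []" using ys(1) by (cases ys; force)+
  moreover have "weighted_zero_sum n A ys'"
    using ys(2) weighted_zero_sum_filter_nonzero[OF assms(1,2)] by (simp add: ys')
  moreover have "sublist ys' xs" by (auto simp: xs sublist_def)
  ultimately show False using free by (auto simp: has_block_def)
qed

lemma no_adjacent_zeros:
  assumes "1 < n" "A \<noteq> {}"
    and free: "\<not> has_block (\<lambda>xs. weighted_zero_sum n A xs \<and> length xs \<noteq> 1) xs"
  shows "\<not> sublist [0, 0] xs"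
proof
  assume "sublist [0, 0] xs"
  moreover have "weighted_zero_sum n A [0, 0]"
    using assms(1,2) by (auto simp: weighted_zero_sum_iff)
  ultimately show False using free unfolding has_block_def by fastforce
qed

text \<open>Deleting the zeros of a zero-sum block gives a zero-sum block of \<open>xs\<close>. It
  is non-empty: a block of at least two zeros would put two zeros side by side, while
  \<open>xs\<close> contains none, as \<open>[0]\<close> is itself zero-sum.\<close>

lemma block_free_zero_interleave:
  assumes "1 < n" "A \<noteq> {}"
    and free: "\<not> has_block (weighted_zero_sum n A) xs"
  shows "\<not> has_block (\<lambda>xs. weighted_zero_sum n A xs \<and> length xs \<noteq> 1) (zero_interleave n xs)"
proof
  assume "has_block (\<lambda>xs. weighted_zero_sum n A xs \<and> length xs \<noteq> 1) (zero_interleave n xs)"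
  then obtain ys where ys: "ys \<noteq> []" "length ys \<noteq> 1" "weighted_zero_sum n A ys"
    and sub: "sublist ys (zero_interleave n xs)"
    by (auto simp: has_block_def)
  have "0 \<notin> set xs"
  proof
    assume "0 \<in> set xs"
    then have "sublist [0] xs" by (auto simp: sublist_def dest: split_list)
    moreover have "weighted_zero_sum n A [0]"
      using assms(1,2) by (auto simp: weighted_zero_sum_iff)
    ultimately show False using free by (auto simp: has_block_def)
  qed
  then have "filter (\<lambda>x. x \<noteq> 0) (zero_interleave n xs) = xs"
    unfolding filter_zero_interleave by (auto simp: filter_id_conv)
  then have "sublist (filter (\<lambda>x. x \<noteq> 0) ys) xs"
    using sub unfolding sublist_def by (metis filter_append)
  moreover have "filter (\<lambda>x. x \<noteq> 0) ys \<noteq> []"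
  proof
    assume zeros: "filter (\<lambda>x. x \<noteq> 0) ys = []"
    obtain y z zs where "ys = y # z # zs" using ys(1,2) by (cases ys; cases "tl ys") auto
    with zeros have "sublist [0, 0] ys" by (auto simp: sublist_Cons_right split: if_splits)
    then show False
      using no_adjacent_zeros_zero_interleave[OF \<open>0 \<notin> set xs\<close>] sub
      by (meson sublist_order.order_trans)
  qed
  ultimately show False
    using free ys(3) weighted_zero_sum_filter_nonzero[OF assms(1,2)]
    by (auto simp: has_block_def)
qed

section \<open>Characterisation of extremal sequences\<close>

lemma C_extremal2_iff_zero_interleave:
  assumes n: "3 \<le> n" and A: "A \<noteq> {}" "A \<subseteq> Units (residue_ring n)"
  shows "C_extremal2 n A (nonzero_residues n) S \<longleftrightarrow>
    (\<exists>xs. C_extremal n A xs \<and> S = zero_interleave n xs)"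
proof -
  define P where "P = weighted_zero_sum n A"
  define Q where "Q = (\<lambda>xs. P xs \<and> length xs \<noteq> 1)"
  define nz where "nz = filter (\<lambda>x::int. x \<noteq> 0)"
  let ?free = "\<lambda>P xs. set xs \<subseteq> carrier (residue_ring n) \<and> \<not> has_block P xs"
  have n1: "1 < n" using n by simp
  have Q: "weighted_zero_sum2 n A (nonzero_residues n) = Q"
    using weighted_zero_sum2_iff_length[OF n A(2)] by (auto simp: Q_def P_def)
  have nz: "?free P (nz xs)" if "?free Q xs" for xs
    using that block_free_filter_nonzero[OF n1 A, of xs] by (auto simp: nz_def P_def Q_def)
  have adj: "\<not> sublist [0, 0] xs" if "?free Q xs" for xs
    using that no_adjacent_zeros[OF n1 A(1), of xs] by (auto simp: P_def Q_def)
  have len: "length xs \<le> 2 * length (nz xs) + 1" if "?free Q xs" for xs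
    using length_no_adjacent_zeros[OF adj[OF that]] by (simp add: nz_def)
  have interleave: "?free Q (zero_interleave n xs)" if "?free P xs" for xs
    using that block_free_zero_interleave[OF n1 A(1), of xs] n
    by (auto simp: P_def Q_def set_zero_interleave carrier_residue_ring)
  have boundP: "length xs < nat n" if "set xs \<subseteq> carrier (residue_ring n)" "\<not> has_block P xs" for xs
    using has_block_weighted_zero_sum[OF n1 A(1), of xs] that(2) by (auto simp: P_def not_le[symmetric])
  \<comment> \<open>A crude bound from \<open>len\<close> and \<open>boundP\<close>; only finiteness
    matters here.\<close>
  have boundQ: "length xs < 2 * nat n + 1"
    if "set xs \<subseteq> carrier (residue_ring n)" "\<not> has_block Q xs" for xs
    using that len[of xs] nz[of xs] boundP[of "nz xs"] by simp
  have extP: "C_extremal n A xs \<longleftrightarrow> ?free P xs \<and> (\<forall>ys. ?free P ys \<longrightarrow> length ys \<le> length xs)" for xs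
    unfolding C_extremal_def P_def[symmetric]
    by (subst C_extremal_for_iff_longest[OF boundP]) auto
  have extQ: "C_extremal2 n A (nonzero_residues n) xs \<longleftrightarrow>
      ?free Q xs \<and> (\<forall>ys. ?free Q ys \<longrightarrow> length ys \<le> length xs)" for xs
    unfolding C_extremal2_def Q
    by (subst C_extremal_for_iff_longest[OF boundQ]) auto
  show ?thesis
  proof
    assume "C_extremal2 n A (nonzero_residues n) S"
    then have S: "?free Q S" "\<And>ys. ?free Q ys \<Longrightarrow> length ys \<le> length S" by (auto simp: extQ)
    obtain xs where xs: "C_extremal n A xs"
      using exists_C_extremal_for[OF boundP] by (auto simp: C_extremal_def P_def)
    \<comment> \<open>Squeeze: interleaving \<open>xs\<close> bounds the length of \<open>S\<close>
      below, extremality of \<open>xs\<close> bounds the number of non-zero terms of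
      \<open>S\<close> above, and \<open>len\<close> links the two, so equality holds
      throughout.\<close>
    then have "2 * length xs + 1 \<le> length S"
      using S(2)[OF interleave[of xs]] by (simp add: extP length_zero_interleave)
    moreover have "length (nz S) \<le> length xs" using xs nz[OF S(1)] by (simp add: extP)
    moreover note len[OF S(1)]
    ultimately have eq: "length (nz S) = length xs" "length S = 2 * length (nz S) + 1" by simp_all
    then have "C_extremal n A (nz S)" using xs nz[OF S(1)] by (simp add: extP)
    moreover have "S = zero_interleave n (nz S)"
      using zero_interleave_filter_nonzero[OF adj[OF S(1)]] eq(2) by (simp add: nz_def)
    ultimately show "\<exists>xs. C_extremal n A xs \<and> S = zero_interleave n xs" by blast
  next
    assume "\<exists>xs. C_extremal n A xs \<and> S = zero_interleave n xs"
    then obtain xs where xs: "C_extremal n A xs" and S: "S = zero_interleave n xs" by blast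
    have "length ys \<le> length S" if "?free Q ys" for ys
    proof -
      have "length (nz ys) \<le> length xs" using xs nz[OF that] by (simp add: extP)
      with len[OF that] show ?thesis by (simp add: S length_zero_interleave)
    qed
    then show "C_extremal2 n A (nonzero_residues n) S"
      using xs interleave[of xs] by (simp add: extP extQ S)
  qed
qed

section \<open>The modulus 2\<close>

lemma C_extremal_mod_2: "C_extremal 2 {1} xs \<longleftrightarrow> xs = [1]"
proof -
  let ?P = "weighted_zero_sum 2 {1}"
  have U: "{1} \<subseteq> Units (residue_ring 2)" by (simp add: Units_residue_ring_iff)
  have carrier: "carrier (residue_ring 2) = {0, 1}" by (auto simp: carrier_residue_ring)
  have single: "?P [x] \<longleftrightarrow> x = 0" if "x \<in> {0, 1}" for x
    using weighted_zero_sum_singleton[of 2 "{1}" x] that U by (auto simp: carrier_residue_ring)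
  have block: "has_block ?P [x] \<longleftrightarrow> ?P [x]" for x
    by (auto simp: has_block_def sublist_Cons_right prefix_Cons)
  \<comment> \<open>The pigeonhole on prefix sums with two residues: any two terms already contain a
    zero-sum block.\<close>
  have bound: "length ys < 2" if "\<not> has_block ?P ys" for ys
    using has_block_weighted_zero_sum[of 2 "{1}" ys] that by (auto simp: not_le[symmetric])
  have "C_extremal 2 {1} xs \<longleftrightarrow> set xs \<subseteq> {0, 1} \<and> \<not> has_block ?P xs \<and>
      (\<forall>ys. set ys \<subseteq> {0, 1} \<and> \<not> has_block ?P ys \<longrightarrow> length ys \<le> length xs)"
    using C_extremal_for_iff_longest[OF bound, of 2 ?P xs]
    unfolding C_extremal_def carrier .
  also have "\<dots> \<longleftrightarrow> xs = [1]"
  proof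
    assume *: "set xs \<subseteq> {0, 1} \<and> \<not> has_block ?P xs \<and>
      (\<forall>ys. set ys \<subseteq> {0, 1} \<and> \<not> has_block ?P ys \<longrightarrow> length ys \<le> length xs)"
    moreover have "\<not> has_block ?P [1]" using single[of 1] block[of 1] by simp
    ultimately have "length [1::int] \<le> length xs" by (metis empty_set insertCI list.simps(15) subsetI)
    moreover have "length xs < 2" using bound * by blast
    ultimately obtain x where x: "xs = [x]" by (cases xs; cases "tl xs") auto
    then show "xs = [1]" using * single[of x] block[of x] by auto
  next
    assume "xs = [1]"
    moreover have "\<not> has_block ?P [1]" using single[of 1] block[of 1] by simp
    moreover have "length ys \<le> 1" if "\<not> has_block ?P ys" for ys using bound[OF that] by simp
    ultimately show "set xs \<subseteq> {0, 1} \<and> \<not> has_block ?P xs \<and>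
      (\<forall>ys. set ys \<subseteq> {0, 1} \<and> \<not> has_block ?P ys \<longrightarrow> length ys \<le> length xs)"
      by simp
  qed
  finally show ?thesis .
qed

lemma C_extremal2_mod_2_iff:
  "C_extremal2 2 {1} (nonzero_residues 2) S \<longleftrightarrow> S = [1, 0, 1] \<or> S = [0, 1, 0]"
proof -
  define P where "P = weighted_zero_sum2 2 {1} (nonzero_residues 2)"
  have P: "P xs \<longleftrightarrow> even (length xs) \<and> even (sum_list xs)" for xs
    unfolding P_def by (rule weighted_zero_sum2_mod_2)
  have ext: "C_extremal_for 2 P [1, 0, 1]"
    using C_extremal2_mod_2 by (simp add: C_extremal2_def P_def)
  \<comment> \<open>The known extremal sequence \<open>[1, 0, 1]\<close> reveals that
    \<open>C_const 2 P - 1\<close> is 3.\<close>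
  then have iff: "C_extremal_for 2 P S \<longleftrightarrow> set S \<subseteq> {0, 1} \<and> length S = 3 \<and> \<not> has_block P S"
    by (auto simp: C_extremal_for_def carrier_residue_ring)
  have "S = [1, 0, 1] \<or> S = [0, 1, 0]" if "C_extremal_for 2 P S"
  proof -
    have "length S = 3" "set S \<subseteq> {0, 1}" and free: "\<not> has_block P S"
      using that unfolding iff by auto
    then obtain a b c where S: "S = [a, b, c]" and abc: "{a, b, c} \<subseteq> {0, 1}"
      by (auto simp: length_Suc_conv numeral_eq_Suc)
    have "sublist [a, b] S" "sublist [b, c] S" by (auto simp: S sublist_Cons_right)
    \<comment> \<open>Adjacent terms must have odd sum, so zeros and ones alternate and only two
      sequences remain.\<close>
    then have "\<not> P [a, b]" "\<not> P [b, c]" using free unfolding has_block_def by blast+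
    then show ?thesis using abc unfolding S P by auto
  qed
  moreover have "\<not> has_block P [0, 1, 0]"
    by (auto simp: has_block_def P sublist_Cons_right prefix_Cons)
  then have "C_extremal_for 2 P [0, 1, 0]"
    using ext by (auto simp: C_extremal_for_def)
  ultimately show ?thesis using ext by (auto simp: C_extremal2_def P_def[symmetric])
qed

theorem theorem21:
  fixes n :: int and A :: "int set" and S :: "int list"
  assumes "n \<ge> 2"
    and "A \<noteq> {}"
    and "A \<subseteq> Units (residue_ring n)"
    and "set S \<subseteq> carrier (residue_ring n)"
    and "\<not> (n = 2 \<and> S = [1, 0, 1])"
  shows "C_extremal2 n A (nonzero_residues n) S \<longleftrightarrow>
    (\<exists>xs. C_extremal n A xs \<and> S = zero_interleave n xs)"
proof (cases "n = 2")
  case True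
  have "Units (residue_ring 2) = {1}"
    by (auto simp: Units_residue_ring_iff)
  then have "A = {1}" using assms(2,3) True by (metis subset_singletonD)
  \<comment> \<open>Of the two extremal sequences, \<open>[1, 0, 1]\<close> is excluded by
    assumption and \<open>[0, 1, 0]\<close> interleaves \<open>[1]\<close>, the only extremal
    sequence for \<open>{1}\<close>.\<close>
  with True assms(5) show ?thesis
    by (auto simp: C_extremal2_mod_2_iff C_extremal_mod_2 zero_residue_ring)
next
  case False
  with assms(1) have "3 \<le> n" by simp
  then show ?thesis using assms(2,3) by (rule C_extremal2_iff_zero_interleave)
qed

end
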